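(* Let $D$ be an $n\times n$ doubly stochastic matrix and let $h=h(D)$. Let $P$ be an $n\times n$ permutation matrix such that \[ P^{\intercal}DP = D_1 \oplus D_2 \oplus \cdots \oplus D_r, \] where each $D_i$ is an irreducible $n_i\times n_i$ doubly stochastic matrix. Then $\lim_{m\to\infty}D^m$ exists if and only if $D$ has precisely $h$ eigenvalues equal to $1$ (counted with multiplicity). Moreover, in this case, $r=h$ and \[ \lim_{m\to\infty} D^m = P \left(J_{n_1} \oplus J_{n_2} \oplus \cdots \oplus J_{n_r}\right) P^{\intercal}. \]
   Context: A square matrix is doubly stochastic if its entries are nonnegative reals and each row and column sums to $1$. A square matrix $A$ is reducible if there is a permutation matrix $P$ such that $P^{\intercal}AP=\begin{bmatrix} A_1 & 0 \\ A_3 & A_2 \end{bmatrix}$ with $A_1,A_2$ square (nonempty) blocks; otherwise it is irreducible. It is a known fact that every doubly stochastic matrix admits a decomposition as in the claim (with $r=1$ when $D$ is irreducible). For a square matrix $A$, $h(A)$ is the number of eigenvalues of $A$ of modulus equal to the spectral radius $\rho(A)$, counted with multiplicity; for doubly stochastic $D$ one has $\rho(D)=1$. $J_k$ is the $k\times k$ matrix with all entries $1/k$, and $\oplus$ denotes the block-diagonal direct sum. *)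

theory Defs
  imports "Jordan_Normal_Form.Spectral_Radius"
begin

definition permutation_mat :: "nat \<Rightarrow> 'a :: {zero,one} mat \<Rightarrow> bool" where
  "permutation_mat n P \<longleftrightarrow>
    (\<exists>\<sigma>. \<sigma> permutes {..<n} \<and> P = mat n n (\<lambda>(i, j). if i = \<sigma> j then 1 else 0))"

definition doubly_stochastic :: "real mat \<Rightarrow> bool" where
  "doubly_stochastic A \<longleftrightarrow> square_mat A \<and>
    (\<forall>i<dim_row A. \<forall>j<dim_col A. 0 \<le> A $$ (i, j)) \<and>
    (\<forall>i<dim_row A. (\<Sum>j<dim_col A. A $$ (i, j)) = 1) \<and>
    (\<forall>j<dim_col A. (\<Sum>i<dim_row A. A $$ (i, j)) = 1)"

definition reducible_mat :: "'a :: semiring_1 mat \<Rightarrow> bool" where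
  "reducible_mat A \<longleftrightarrow>
    (\<exists>n k P A1 A2 A3. A \<in> carrier_mat n n \<and> permutation_mat n P \<and> 0 < k \<and> k < n \<and>
      A1 \<in> carrier_mat k k \<and> A2 \<in> carrier_mat (n - k) (n - k) \<and> A3 \<in> carrier_mat (n - k) k \<and>
      P\<^sup>T * A * P = four_block_mat A1 (0\<^sub>m k (n - k)) A3 A2)"

definition irreducible_mat :: "'a :: semiring_1 mat \<Rightarrow> bool" where
  "irreducible_mat A \<longleftrightarrow> square_mat A \<and> \<not> reducible_mat A"

(* Eigenvalues are counted with algebraic multiplicity. *)
definition eigenvalue_multiplicity :: "complex mat \<Rightarrow> complex \<Rightarrow> nat" where
  "eigenvalue_multiplicity A z = order z (char_poly A)"

(* The number h(A) of eigenvalues of maximal modulus. *)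
definition peripheral_count :: "complex mat \<Rightarrow> nat" where
  "peripheral_count A =
    (\<Sum>z\<in>{z \<in> spectrum A. cmod z = spectral_radius A}. eigenvalue_multiplicity A z)"

definition J_mat :: "nat \<Rightarrow> real mat" where
  "J_mat k = mat k k (\<lambda>_. 1 / real k)"

(* The type of matrices of all dimensions carries no topology; convergence of
   matrices of a fixed format is entrywise. *)
definition mat_tendsto :: "(nat \<Rightarrow> real mat) \<Rightarrow> real mat \<Rightarrow> bool" where
  "mat_tendsto X L \<longleftrightarrow>
    (\<forall>m. X m \<in> carrier_mat (dim_row L) (dim_col L)) \<and>
    (\<forall>i<dim_row L. \<forall>j<dim_col L. (\<lambda>m. X m $$ (i, j)) \<longlonglongrightarrow> L $$ (i, j))"

end

theory Submission
  imports Defs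
begin

text \<open>Let \<open>K\<close> be the asserted limit. Blockwise, row and column sums give \<open>D K = K D = K\<close>, and the
  maximum principle for irreducible blocks shows that \<open>K\<close> fixes every fixed vector of \<open>D\<close>. Hence
  \<open>D\<^sup>m - K = (D - K)\<^sup>m\<close> for \<open>m > 0\<close>, and a nonzero eigenvalue of \<open>D - K\<close> is an eigenvalue
  of \<open>D\<close> other than \<open>1\<close>; so \<open>D\<^sup>m\<close> tends to \<open>K\<close> as soon as \<open>1\<close> is the only eigenvalue of
  modulus \<open>1\<close>. Conversely, if the powers converge, an eigenvector for \<open>z\<close> of modulus \<open>1\<close> makes
  \<open>z\<^sup>m\<close> converge, which forces \<open>z = 1\<close>. Finally, \<open>1\<close> is an algebraically simple eigenvalue of
  each irreducible block, so its multiplicity in \<open>D\<close> is the number of blocks.\<close>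

section \<open>Limits of matrix powers\<close>

text \<open>These relations say that \<open>K\<close> is the projection onto the fixed space of
  \<open>D\<close> along the range of \<open>D - 1\<close>. They are purely algebraic, so unlike
  irreducibility they pass to direct sums and to similar matrices.\<close>

definition absorbing_pair :: "nat \<Rightarrow> 'a :: field mat \<Rightarrow> 'a mat \<Rightarrow> bool" where
  "absorbing_pair n D K \<longleftrightarrow> D \<in> carrier_mat n n \<and> K \<in> carrier_mat n n \<and> D * K = K \<and> K * D = K \<and>
    (\<forall>v \<in> carrier_vec n. D *\<^sub>v v = v \<longrightarrow> K *\<^sub>v v = v)"

text \<open>By \<open>D * K = K\<close> every column of \<open>K\<close> is a fixed vector of
  \<open>D\<close>, and \<open>K\<close> leaves such vectors unchanged.\<close>

lemma absorbing_pair_idem: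
  assumes "absorbing_pair n D K"
  shows "K * K = K"
proof (rule eq_matI)
  have D: "D \<in> carrier_mat n n" and K: "K \<in> carrier_mat n n" and DK: "D * K = K"
    and fix_K: "\<And>v. v \<in> carrier_vec n \<Longrightarrow> D *\<^sub>v v = v \<Longrightarrow> K *\<^sub>v v = v"
    using assms unfolding absorbing_pair_def by auto
  show "dim_row (K * K) = dim_row K" "dim_col (K * K) = dim_col K" by auto
  fix i j assume "i < dim_row K" "j < dim_col K"
  hence i: "i < n" and j: "j < n" using K by auto
  have "D *\<^sub>v col K j = col K j" using col_mult2[OF D K j] DK by simp
  hence "K *\<^sub>v col K j = col K j" using K j by (intro fix_K) auto
  hence "col (K * K) j = col K j" using col_mult2[OF K K j] by simp
  from arg_cong[OF this, of "\<lambda>v. v $ i"] show "(K * K) $$ (i, j) = K $$ (i, j)"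
    using K i j by simp
qed

lemma absorbing_pair_four_block:
  assumes "absorbing_pair n D K" "absorbing_pair m D' K'"
  shows "absorbing_pair (n + m) (four_block_mat D (0\<^sub>m n m) (0\<^sub>m m n) D')
    (four_block_mat K (0\<^sub>m n m) (0\<^sub>m m n) K')"
proof -
  have D: "D \<in> carrier_mat n n" and K: "K \<in> carrier_mat n n" and DK: "D * K = K" "K * D = K"
    and fix_K: "\<And>v. v \<in> carrier_vec n \<Longrightarrow> D *\<^sub>v v = v \<Longrightarrow> K *\<^sub>v v = v"
    using assms(1) unfolding absorbing_pair_def by auto
  have D': "D' \<in> carrier_mat m m" and K': "K' \<in> carrier_mat m m" and DK': "D' * K' = K'" "K' * D' = K'"
    and fix_K': "\<And>v. v \<in> carrier_vec m \<Longrightarrow> D' *\<^sub>v v = v \<Longrightarrow> K' *\<^sub>v v = v"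
    using assms(2) unfolding absorbing_pair_def by auto
  note z = zero_carrier_mat[of n m] zero_carrier_mat[of m n]
  have mult: "four_block_mat X (0\<^sub>m n m) (0\<^sub>m m n) X' * four_block_mat Y (0\<^sub>m n m) (0\<^sub>m m n) Y'
    = four_block_mat (X * Y) (0\<^sub>m n m) (0\<^sub>m m n) (X' * Y')"
    if "X \<in> carrier_mat n n" "Y \<in> carrier_mat n n" "X' \<in> carrier_mat m m" "Y' \<in> carrier_mat m m"
    for X Y X' Y' :: "'a mat"
    using that by (subst mult_four_block_mat[of _ n n _ m _ m _ _ n _ m]) auto
  have "four_block_mat K (0\<^sub>m n m) (0\<^sub>m m n) K' *\<^sub>v v = v"
    if v: "v \<in> carrier_vec (n + m)"
      and fixed: "four_block_mat D (0\<^sub>m n m) (0\<^sub>m m n) D' *\<^sub>v v = v" for v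
  proof -
    let ?a = "vec_first v n" and ?b = "vec_last v m"
    have ab: "v = ?a @\<^sub>v ?b" using v by simp
    have "(D *\<^sub>v ?a) @\<^sub>v (D' *\<^sub>v ?b) = ?a @\<^sub>v ?b"
      using fixed mult_mat_vec_split[OF D D', of ?a ?b] ab by simp
    hence "D *\<^sub>v ?a = ?a \<and> D' *\<^sub>v ?b = ?b"
      using D by (subst (asm) append_vec_eq[of _ n]) auto
    hence "K *\<^sub>v ?a = ?a" "K' *\<^sub>v ?b = ?b" using fix_K fix_K' by auto
    thus ?thesis using mult_mat_vec_split[OF K K', of ?a ?b] ab by simp
  qed
  thus ?thesis unfolding absorbing_pair_def
    using mult[OF D K D' K'] mult[OF K D K' D'] DK DK' D K D' K' by simp
qed

lemma absorbing_pair_similar: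
  assumes "absorbing_pair n D K" and P: "P \<in> carrier_mat n n" and Q: "Q \<in> carrier_mat n n"
    and QP: "Q * P = 1\<^sub>m n" and PQ: "P * Q = 1\<^sub>m n"
  shows "absorbing_pair n (P * D * Q) (P * K * Q)"
proof -
  have D: "D \<in> carrier_mat n n" and K: "K \<in> carrier_mat n n" and DK: "D * K = K" "K * D = K"
    and fix_K: "\<And>v. v \<in> carrier_vec n \<Longrightarrow> D *\<^sub>v v = v \<Longrightarrow> K *\<^sub>v v = v"
    using assms(1) unfolding absorbing_pair_def by auto
  have mult: "(P * X * Q) * (P * Y * Q) = P * (X * Y) * Q"
    if X: "X \<in> carrier_mat n n" and Y: "Y \<in> carrier_mat n n" for X Y :: "'a mat"
  proof -
    have "(P * X * Q) * (P * Y * Q) = P * X * (Q * P) * Y * Q"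
      using X Y P Q by (simp add: assoc_mult_mat[of _ n n _ n _ n])
    also have "\<dots> = P * (X * Y) * Q"
      using X Y P Q by (simp add: QP assoc_mult_mat[of _ n n _ n _ n])
    finally show ?thesis .
  qed
  have vec: "(P * X * Q) *\<^sub>v v = P *\<^sub>v (X *\<^sub>v (Q *\<^sub>v v))"
    if "X \<in> carrier_mat n n" "v \<in> carrier_vec n" for X v
    using that P Q by (simp add: assoc_mult_mat_vec[of _ n n _ n])
  have "P * K * Q *\<^sub>v v = v" if v: "v \<in> carrier_vec n" and fixed: "P * D * Q *\<^sub>v v = v" for v
  proof -
    have Qv: "Q *\<^sub>v v \<in> carrier_vec n" using Q v by simp
    have cancel: "Q *\<^sub>v (P *\<^sub>v w) = w" "P *\<^sub>v (Q *\<^sub>v w) = w" if "w \<in> carrier_vec n" for w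
      using assoc_mult_mat_vec[OF Q P that] assoc_mult_mat_vec[OF P Q that] QP PQ that by simp_all
    \<comment> \<open>The change of basis \<open>Q\<close> carries fixed vectors of
      \<open>P * D * Q\<close> to fixed vectors of \<open>D\<close>.\<close>
    have "D *\<^sub>v (Q *\<^sub>v v) = Q *\<^sub>v (P * D * Q *\<^sub>v v)"
      unfolding vec[OF D v] using D Qv by (subst cancel) auto
    hence "D *\<^sub>v (Q *\<^sub>v v) = Q *\<^sub>v v" unfolding fixed .
    hence "K *\<^sub>v (Q *\<^sub>v v) = Q *\<^sub>v v" using fix_K Qv by blast
    thus ?thesis unfolding vec[OF K v] using cancel v by simp
  qed
  thus ?thesis unfolding absorbing_pair_def using mult D K DK P Q by simp
qed

text \<open>Spectral radius below 1 gives a bound uniform in the exponent but no decay. Decay comes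
  from rescaling: with \<open>s\<close> strictly between the spectral radius and 1, the powers of
  \<open>B / s\<close> are still bounded by some \<open>c\<close>, so the entries of the m-th power
  of \<open>B\<close> are at most \<open>s ^ m * c\<close>.\<close>

lemma pow_mat_tendsto_0:
  fixes B :: "complex mat"
  assumes B: "B \<in> carrier_mat n n" and ev: "\<And>z. eigenvalue B z \<Longrightarrow> cmod z < 1"
    and i: "i < n" and j: "j < n"
  shows "(\<lambda>m. (B ^\<^sub>m m) $$ (i, j)) \<longlonglongrightarrow> 0"
proof -
  have n: "0 < n" using i by simp
  have "spectral_radius B < 1"
    using spectral_radius_mem_max(1)[OF B n] ev unfolding spectrum_def by auto
  moreover have "0 \<le> spectral_radius B"
    using spectral_radius_mem_max(1)[OF B n] by auto
  ultimately obtain s where s: "spectral_radius B < s" "s < 1" "0 < s"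
    using dense by (metis le_less_trans)
  let ?k = "complex_of_real (1 / s)"
  let ?C = "?k \<cdot>\<^sub>m B"
  have C: "?C \<in> carrier_mat n n" using B by simp
  have k: "?k \<noteq> 0" using s by simp
  \<comment> \<open>If \<open>z\<close> is an eigenvalue of \<open>B / s\<close>, then
    \<open>s * z\<close> is one of \<open>B\<close>, so \<open>s * cmod z\<close> is at most the
    spectral radius of \<open>B\<close>, which is below \<open>s\<close>.\<close>
  have "spectral_radius ?C < 1"
  proof -
    obtain z where z: "eigenvalue ?C z" "spectral_radius ?C = cmod z"
      using spectral_radius_mem_max(1)[OF C n] unfolding spectrum_def by auto
    then obtain v where v: "v \<in> carrier_vec n" "v \<noteq> 0\<^sub>v n" "?C *\<^sub>v v = z \<cdot>\<^sub>v v"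
      unfolding eigenvalue_def eigenvector_def using B by auto
    have sk: "complex_of_real s * ?k = 1" using s by (simp flip: of_real_mult)
    have "B *\<^sub>v v = (complex_of_real s * ?k) \<cdot>\<^sub>v (B *\<^sub>v v)" unfolding sk by simp
    also have "\<dots> = complex_of_real s \<cdot>\<^sub>v (?C *\<^sub>v v)"
      using B v(1) by (intro eq_vecI) (auto simp: scalar_prod_def sum_distrib_left mult.assoc)
    also have "\<dots> = (complex_of_real s * z) \<cdot>\<^sub>v v" unfolding v(3) by (simp add: smult_smult_assoc)
    finally have "eigenvalue B (complex_of_real s * z)"
      unfolding eigenvalue_def eigenvector_def using v B by auto
    hence "cmod (complex_of_real s * z) \<le> spectral_radius B"
      using spectral_radius_mem_max(2)[OF B n] unfolding spectrum_def by blast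
    hence "s * cmod z \<le> spectral_radius B" using s by (simp add: norm_mult)
    hence "s * cmod z < s * 1" using s(1) by linarith
    thus ?thesis using s(3) z(2) mult_less_cancel_left_pos by metis
  qed
  from spectral_radius_jnf_norm_bound_less_1_upper_triangular[OF C this]
  obtain c where c: "\<And>m. norm_bound (?C ^\<^sub>m m) c" by auto
  have pow: "?C ^\<^sub>m m = ?k ^ m \<cdot>\<^sub>m (B ^\<^sub>m m)" for m
  proof (induct m)
    case 0
    show ?case using B by (intro eq_matI) auto
  next
    case (Suc m)
    have Bm: "B ^\<^sub>m m \<in> carrier_mat n n" using B by simp
    have "?C ^\<^sub>m Suc m = (?k ^ m \<cdot>\<^sub>m (B ^\<^sub>m m)) * (?k \<cdot>\<^sub>m B)" using Suc by simp
    also have "\<dots> = ?k ^ m \<cdot>\<^sub>m (?k \<cdot>\<^sub>m (B ^\<^sub>m m * B))"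
      using mult_smult_assoc_mat[OF Bm smult_carrier_mat[OF B]] mult_smult_distrib[OF Bm B] by simp
    also have "\<dots> = ?k ^ Suc m \<cdot>\<^sub>m (B ^\<^sub>m Suc m)"
      using B by (intro eq_matI) (auto simp del: index_mult_mat(1))
    finally show ?case .
  qed
  have "cmod ((B ^\<^sub>m m) $$ (i, j)) \<le> s ^ m * c" for m
  proof -
    have "cmod ((?C ^\<^sub>m m) $$ (i, j)) \<le> c" using c[of m] i j
      unfolding norm_bound_def pow_mat_dim_square[OF C] by blast
    hence "cmod ((B ^\<^sub>m m) $$ (i, j)) / s ^ m \<le> c"
      unfolding pow using B i j s by (simp add: norm_mult norm_power norm_divide power_one_over)
    thus ?thesis using s by (simp add: field_simps)
  qed
  moreover have "(\<lambda>m. s ^ m) \<longlonglongrightarrow> 0"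
    using s by (intro LIMSEQ_power_zero) auto
  ultimately show ?thesis using s(3) by (elim tendsto_0_le[where K = c]) simp
qed

text \<open>Subtracting \<open>K\<close> deflates the eigenvalue 1: what remains has only
  eigenvalues of modulus below 1, and its positive powers are exactly the errors of the powers of
  \<open>D\<close> against \<open>K\<close>.\<close>

lemma absorbing_pair_pow_tendsto:
  fixes D :: "complex mat"
  assumes "absorbing_pair n D K" and ev: "\<And>z. eigenvalue D z \<Longrightarrow> cmod z < 1 \<or> z = 1"
    and i: "i < n" and j: "j < n"
  shows "(\<lambda>m. (D ^\<^sub>m m) $$ (i, j)) \<longlonglongrightarrow> K $$ (i, j)"
proof -
  have D: "D \<in> carrier_mat n n" and K: "K \<in> carrier_mat n n" and DK: "D * K = K" "K * D = K"
    and fix_K: "\<And>v. v \<in> carrier_vec n \<Longrightarrow> D *\<^sub>v v = v \<Longrightarrow> K *\<^sub>v v = v"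
    using assms(1) unfolding absorbing_pair_def by auto
  note KK = absorbing_pair_idem[OF assms(1)]
  have B: "D - K \<in> carrier_mat n n" by (rule minus_carrier_mat[OF K])
  have pow_carrier: "D ^\<^sub>m m \<in> carrier_mat n n" for m using D by simp
  have pow_K: "D ^\<^sub>m m * K = K" for m
    using D K by (induct m) (auto simp: DK assoc_mult_mat[of _ n n _ n _ n])
  \<comment> \<open>The identity starts at exponent 1; at exponent 0 the left side would be the
    identity and the right side the identity minus \<open>K\<close>.\<close>
  have pow: "(D - K) ^\<^sub>m Suc m = D ^\<^sub>m Suc m - K" for m
  proof (induct m)
    case 0
    show ?case using D K by simp
  next
    case (Suc m)
    have "(D - K) ^\<^sub>m Suc (Suc m) = (D ^\<^sub>m Suc m - K) * (D - K)" using Suc by simp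
    also have "\<dots> = (D ^\<^sub>m Suc m - K) * D - (D ^\<^sub>m Suc m - K) * K"
      by (rule mult_minus_distrib_mat[OF _ D K]) (use D K in auto)
    also have "(D ^\<^sub>m Suc m - K) * D = D ^\<^sub>m Suc (Suc m) - K"
      using minus_mult_distrib_mat[OF pow_carrier K D, of "Suc m"] by (simp add: DK)
    also have "(D ^\<^sub>m Suc m - K) * K = K - K"
      using minus_mult_distrib_mat[OF pow_carrier K K, of "Suc m"] pow_K[of "Suc m"] by (simp add: KK)
    also have "D ^\<^sub>m Suc (Suc m) - K - (K - K) = D ^\<^sub>m Suc (Suc m) - K"
      using D K by (intro eq_matI) auto
    finally show ?case .
  qed
  have "cmod z < 1" if z: "eigenvalue (D - K) z" for z
  proof (cases "z = 0")
    case False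
    from z obtain v where v: "v \<in> carrier_vec n" "v \<noteq> 0\<^sub>v n" "(D - K) *\<^sub>v v = z \<cdot>\<^sub>v v"
      unfolding eigenvalue_def eigenvector_def using K by auto
    \<comment> \<open>Since \<open>K\<close> annihilates \<open>D - K\<close>, applying it to the
      eigenvector equation gives \<open>z\<close> times \<open>K v\<close> equal to zero. For
      nonzero \<open>z\<close> the vector \<open>v\<close> is thus in the kernel of
      \<open>K\<close>, where \<open>D - K\<close> and \<open>D\<close> agree.\<close>
    have "K * (D - K) = 0\<^sub>m n n"
      using mult_minus_distrib_mat[OF K D K] K by (simp add: DK KK)
    moreover have "0\<^sub>m n n *\<^sub>v v = 0\<^sub>v n" using v(1) by (intro eq_vecI) auto
    ultimately have "0\<^sub>v n = K *\<^sub>v (z \<cdot>\<^sub>v v)"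
      using assoc_mult_mat_vec[OF K B v(1)] v(3) by simp
    also have "\<dots> = z \<cdot>\<^sub>v (K *\<^sub>v v)" using mult_mat_vec[OF K v(1)] .
    finally have zKv: "z \<cdot>\<^sub>v (K *\<^sub>v v) = 0\<^sub>v n" by simp
    have Kv: "K *\<^sub>v v = 0\<^sub>v n"
    proof (rule eq_vecI)
      fix i assume "i < dim_vec (0\<^sub>v n)"
      hence "i < n" by simp
      moreover from arg_cong[OF zKv, of "\<lambda>v. v $ i"] have "(z \<cdot>\<^sub>v (K *\<^sub>v v)) $ i = 0"
        using \<open>i < n\<close> by simp
      ultimately show "(K *\<^sub>v v) $ i = 0\<^sub>v n $ i" using False K by simp
    qed (use K in auto)
    have "D *\<^sub>v v = z \<cdot>\<^sub>v v"
      using minus_mult_distrib_mat_vec[OF D K v(1)] v Kv D by simp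
    hence "eigenvalue D z" and "z = 1 \<Longrightarrow> D *\<^sub>v v = v"
      unfolding eigenvalue_def eigenvector_def using v D by auto
    \<comment> \<open>The value \<open>z = 1\<close> is excluded: \<open>v\<close> would be fixed by
      \<open>D\<close>, hence by \<open>K\<close>, but \<open>K\<close> sends it to zero.\<close>
    with ev[of z] fix_K[OF v(1)] Kv v(2) show ?thesis by auto
  qed simp
  from pow_mat_tendsto_0[OF B this i j]
  have "(\<lambda>m. ((D - K) ^\<^sub>m Suc m) $$ (i, j)) \<longlonglongrightarrow> 0" by (rule LIMSEQ_Suc)
  hence "(\<lambda>m. (D ^\<^sub>m Suc m) $$ (i, j) - K $$ (i, j)) \<longlonglongrightarrow> 0"
    unfolding pow using D K i j by simp
  hence "(\<lambda>m. (D ^\<^sub>m Suc m) $$ (i, j)) \<longlonglongrightarrow> K $$ (i, j)" by (simp add: LIM_zero_iff)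
  thus ?thesis by (rule LIMSEQ_imp_Suc)
qed

text \<open>A root of multiplicity two yields a plane on which \<open>A\<close> is upper triangular
  with \<open>e\<close> twice on the diagonal; it is spanned by the first two vectors of a Schur
  basis. The scalar \<open>t\<close> may vanish, so a two-dimensional eigenspace and a Jordan block
  are handled together. Independence of \<open>p\<close> and \<open>q\<close> is expressed by
  \<open>p\<close> being nonzero and \<open>q\<close> not being a multiple of it.\<close>

lemma order_char_poly_ge_2E:
  fixes A :: "complex mat"
  assumes A: "A \<in> carrier_mat n n" and ord: "2 \<le> Polynomial.order e (char_poly A)"
  obtains p q t where "p \<in> carrier_vec n" "q \<in> carrier_vec n" "p \<noteq> 0\<^sub>v n" "A *\<^sub>v p = e \<cdot>\<^sub>v p"
    "A *\<^sub>v q = t \<cdot>\<^sub>v p + e \<cdot>\<^sub>v q" "\<And>c. q \<noteq> c \<cdot>\<^sub>v p"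
proof -
  have "monic (char_poly A)" and deg: "degree (char_poly A) = n"
    using degree_monic_char_poly[OF A] by auto
  from ord have "[:-e, 1:] ^ 2 dvd char_poly A"
    using order_1 le_imp_power_dvd dvd_trans by blast
  then obtain f where f: "char_poly A = [:-e, 1:] ^ 2 * f" by auto
  have "lead_coeff f = 1"
    using \<open>monic (char_poly A)\<close> unfolding f by (simp add: lead_coeff_mult lead_coeff_power)
  moreover from fundamental_theorem_algebra_factorized[of f] obtain es
    where "Polynomial.smult (lead_coeff f) (\<Prod>a\<leftarrow>es. [:- a, 1:]) = f" by blast
  ultimately have fact: "char_poly A = (\<Prod>a\<leftarrow>e # e # es. [:- a, 1:])"
    unfolding f by (simp add: power2_eq_square mult.assoc del: mult_pCons_left)
  obtain B P Q where "schur_decomposition A (e # e # es) = (B, P, Q)" by (metis prod_cases3)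
  from schur_decomposition[OF A fact this]
  have sim: "similar_mat_wit A B P Q" and ut: "upper_triangular B" and diag: "diag_mat B = e # e # es"
    by auto
  from similar_mat_witD2[OF A sim] have PQ: "Q * P = 1\<^sub>m n" and APBQ: "A = P * B * Q"
    and B: "B \<in> carrier_mat n n" and P: "P \<in> carrier_mat n n" and Q: "Q \<in> carrier_mat n n" by auto
  have n: "2 \<le> n" using arg_cong[OF diag, of length] B by (simp add: diag_mat_def)
  have "diag_mat B ! i = B $$ (i, i)" if "i < n" for i using that B by (simp add: diag_mat_def)
  from this[of 0] this[of 1] n have B00: "B $$ (0, 0) = e" and B11: "B $$ (1, 1) = e"
    unfolding diag by simp_all
  have AP: "A *\<^sub>v (P *\<^sub>v w) = P *\<^sub>v (B *\<^sub>v w)" if w: "w \<in> carrier_vec n" for w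
  proof -
    have "A *\<^sub>v (P *\<^sub>v w) = P *\<^sub>v (B *\<^sub>v ((Q * P) *\<^sub>v w))"
      unfolding APBQ using P Q B w by (simp add: assoc_mult_mat_vec[of _ n n _ n])
    thus ?thesis using w unfolding PQ by simp
  qed
  \<comment> \<open>The witnesses are columns 0 and 1 of \<open>P\<close>, the images of these unit
    vectors. The entry \<open>B $$ (0, 1)\<close> serves as \<open>t\<close>.\<close>
  let ?u = "unit_vec n 0 :: complex vec" and ?w = "unit_vec n 1 :: complex vec"
  have uw: "?u \<in> carrier_vec n" "?w \<in> carrier_vec n" by auto
  have Bu: "B *\<^sub>v ?u = e \<cdot>\<^sub>v ?u"
  proof (rule eq_vecI)
    fix i assume "i < dim_vec (e \<cdot>\<^sub>v ?u)"
    thus "(B *\<^sub>v ?u) $ i = (e \<cdot>\<^sub>v ?u) $ i"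
      using B n B00 upper_triangularD[OF ut, of 0 i] by (cases "i = 0") (auto)
  qed (use B in auto)
  have Bw: "B *\<^sub>v ?w = B $$ (0, 1) \<cdot>\<^sub>v ?u + e \<cdot>\<^sub>v ?w"
  proof (rule eq_vecI)
    fix i assume "i < dim_vec (B $$ (0, 1) \<cdot>\<^sub>v ?u + e \<cdot>\<^sub>v ?w)"
    thus "(B *\<^sub>v ?w) $ i = (B $$ (0, 1) \<cdot>\<^sub>v ?u + e \<cdot>\<^sub>v ?w) $ i"
      using B n B11 upper_triangularD[OF ut, of 1 i] by (cases "i = 0"; cases "i = 1") (auto)
  qed (use B in auto)
  have cancel: "Q *\<^sub>v (P *\<^sub>v w) = w" if "w \<in> carrier_vec n" for w
    using assoc_mult_mat_vec[OF Q P that] PQ that by simp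
  show thesis
  proof (rule that)
    show "P *\<^sub>v ?u \<in> carrier_vec n" "P *\<^sub>v ?w \<in> carrier_vec n" using P by auto
    show "P *\<^sub>v ?u \<noteq> 0\<^sub>v n"
    proof
      assume "P *\<^sub>v ?u = 0\<^sub>v n"
      hence "?u = Q *\<^sub>v 0\<^sub>v n" using cancel[OF uw(1)] by simp
      hence "?u $ 0 = (0\<^sub>v n) $ 0" using Q n by (simp add: scalar_prod_def)
      thus False using n by simp
    qed
    show "A *\<^sub>v (P *\<^sub>v ?u) = e \<cdot>\<^sub>v (P *\<^sub>v ?u)"
      unfolding AP[OF uw(1)] Bu using P by (simp add: mult_mat_vec[of _ n n])
    show "A *\<^sub>v (P *\<^sub>v ?w) = B $$ (0, 1) \<cdot>\<^sub>v (P *\<^sub>v ?u) + e \<cdot>\<^sub>v (P *\<^sub>v ?w)"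
      unfolding AP[OF uw(2)] Bw using P
      by (subst mult_add_distrib_mat_vec[OF P]) (auto simp: mult_mat_vec[of _ n n])
    show "P *\<^sub>v ?w \<noteq> c \<cdot>\<^sub>v (P *\<^sub>v ?u)" for c
    proof
      assume "P *\<^sub>v ?w = c \<cdot>\<^sub>v (P *\<^sub>v ?u)"
      also have "\<dots> = P *\<^sub>v (c \<cdot>\<^sub>v ?u)" using P by (simp add: mult_mat_vec[of _ n n])
      finally have "Q *\<^sub>v (P *\<^sub>v ?w) = Q *\<^sub>v (P *\<^sub>v (c \<cdot>\<^sub>v ?u))" by simp
      hence "?w = c \<cdot>\<^sub>v ?u" using cancel[of ?w] cancel[of "c \<cdot>\<^sub>v ?u"] by simp
      from arg_cong[OF this, of "\<lambda>v. v $ 1"] show False using n by simp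
    qed
  qed
qed

section \<open>Permutations and reducibility\<close>

lemma permutation_mat_conj:
  fixes A :: "'a :: comm_ring_1 mat"
  assumes \<sigma>: "\<sigma> permutes {..<n}" and A: "A \<in> carrier_mat n n"
    and P: "P = mat n n (\<lambda>(i, j). if i = \<sigma> j then 1 else 0)"
  shows "P\<^sup>T * A * P = mat n n (\<lambda>(i, j). A $$ (\<sigma> i, \<sigma> j))"
proof (rule eq_matI)
  fix i j assume "i < dim_row (mat n n (\<lambda>(i, j). A $$ (\<sigma> i, \<sigma> j)))"
    "j < dim_col (mat n n (\<lambda>(i, j). A $$ (\<sigma> i, \<sigma> j)))"
  hence i: "i < n" and j: "j < n" by auto
  have \<sigma>_lt: "\<sigma> l < n" if "l < n" for l using permutes_in_image[OF \<sigma>, of l] that by simp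
  have row: "(P\<^sup>T * A) $$ (i, l) = A $$ (\<sigma> i, l)" if "l < n" for l
  proof -
    have "(P\<^sup>T * A) $$ (i, l) = (\<Sum>k<n. (if k = \<sigma> i then 1 else 0) * A $$ (k, l))"
      using that i A by (simp add: P scalar_prod_def atLeast0LessThan)
    also have "\<dots> = (\<Sum>k<n. if k = \<sigma> i then A $$ (k, l) else 0)"
      by (intro sum.cong) auto
    also have "\<dots> = A $$ (\<sigma> i, l)" using \<sigma>_lt[OF i] by simp
    finally show ?thesis .
  qed
  have "(P\<^sup>T * A * P) $$ (i, j) = (\<Sum>l<n. (P\<^sup>T * A) $$ (i, l) * (if l = \<sigma> j then 1 else 0))"
    using i j A by (simp add: P scalar_prod_def atLeast0LessThan)
  also have "\<dots> = (\<Sum>l<n. if l = \<sigma> j then A $$ (\<sigma> i, l) else 0)"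
    by (intro sum.cong) (auto simp: row)
  also have "\<dots> = A $$ (\<sigma> i, \<sigma> j)" using \<sigma>_lt[OF j] by simp
  finally show "(P\<^sup>T * A * P) $$ (i, j) = mat n n (\<lambda>(i, j). A $$ (\<sigma> i, \<sigma> j)) $$ (i, j)"
    using i j by simp
qed (use A in \<open>auto simp: P\<close>)

lemma permutation_mat_orthogonal:
  fixes P :: "'a :: field mat"
  assumes "permutation_mat n P"
  shows "P \<in> carrier_mat n n" "P\<^sup>T * P = 1\<^sub>m n" "P * P\<^sup>T = 1\<^sub>m n"
proof -
  obtain \<sigma> where \<sigma>: "\<sigma> permutes {..<n}" and P: "P = mat n n (\<lambda>(i, j). if i = \<sigma> j then 1 else 0)"
    using assms unfolding permutation_mat_def by auto
  show carrier: "P \<in> carrier_mat n n" by (simp add: P)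
  have "P\<^sup>T * P = P\<^sup>T * 1\<^sub>m n * P" using carrier by simp
  also have "\<dots> = mat n n (\<lambda>(i, j). 1\<^sub>m n $$ (\<sigma> i, \<sigma> j))"
    by (rule permutation_mat_conj[OF \<sigma> _ P]) simp
  also have "\<dots> = 1\<^sub>m n"
  proof (rule eq_matI)
    fix i j assume "i < dim_row (1\<^sub>m n :: 'a mat)" "j < dim_col (1\<^sub>m n :: 'a mat)"
    hence "i < n" "j < n" by auto
    moreover from this have "\<sigma> i < n" "\<sigma> j < n" using permutes_in_image[OF \<sigma>] by auto
    moreover have "\<sigma> i = \<sigma> j \<longleftrightarrow> i = j" using permutes_inj[OF \<sigma>] by (auto dest: injD)
    ultimately show "mat n n (\<lambda>(i, j). 1\<^sub>m n $$ (\<sigma> i, \<sigma> j)) $$ (i, j) = (1\<^sub>m n :: 'a mat) $$ (i, j)"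
      by simp
  qed auto
  finally show PTP: "P\<^sup>T * P = 1\<^sub>m n" .
  show "P * P\<^sup>T = 1\<^sub>m n"
    by (rule mat_mult_left_right_inverse[OF _ carrier PTP]) (use carrier in simp)
qed

lemma doubly_stochasticD:
  assumes "doubly_stochastic A" "A \<in> carrier_mat n n"
  shows "i < n \<Longrightarrow> j < n \<Longrightarrow> 0 \<le> A $$ (i, j)"
    and "i < n \<Longrightarrow> (\<Sum>j<n. A $$ (i, j)) = 1"
    and "j < n \<Longrightarrow> (\<Sum>i<n. A $$ (i, j)) = 1"
  using assms unfolding doubly_stochastic_def by auto

lemma mult_mat_vec_index_sum:
  assumes "A \<in> carrier_mat n n" "v \<in> carrier_vec n" "i < n"
  shows "(A *\<^sub>v v) $ i = (\<Sum>j<n. A $$ (i, j) * v $ j)"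
  using assms by (simp add: scalar_prod_def atLeast0LessThan)

text \<open>Listing the indices of \<open>S\<close> first and those of its complement afterwards
  moves the vanishing entries into the upper right block. Both blocks on the diagonal are nonempty
  because \<open>S\<close> is nonempty and proper.\<close>

lemma reducible_matI:
  fixes A :: "'a :: comm_ring_1 mat"
  assumes A: "A \<in> carrier_mat n n" and S: "S \<subset> {..<n}" "S \<noteq> {}"
    and zero: "\<And>i j. i \<in> S \<Longrightarrow> j < n \<Longrightarrow> j \<notin> S \<Longrightarrow> A $$ (i, j) = 0"
  shows "reducible_mat A"
proof -
  have fin: "finite S" using S(1) finite_subset by blast
  define k where "k = card S"
  have k: "0 < k" "k < n"
    using S fin psubset_card_mono[OF _ S(1)] by (auto simp: k_def card_gt_0_iff)
  obtain f where f: "bij_betw f {..<k} S"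
    using finite_same_card_bij[OF _ fin, of "{..<k}"] by (auto simp: k_def)
  have "card ({..<n} - S) = card {k..<n}"
    using S(1) fin by (simp add: card_Diff_subset k_def psubset_eq)
  then obtain g where g: "bij_betw g {k..<n} ({..<n} - S)"
    using finite_same_card_bij[of "{k..<n}" "{..<n} - S"] by auto
  \<comment> \<open>\<open>f\<close> enumerates \<open>S\<close> on the first \<open>k\<close>
    indices and \<open>g\<close> enumerates the complement on the others; the identity from
    \<open>n\<close> on makes this a permutation of \<open>{..<n}\<close> in the sense of
    \<open>permutes\<close>.\<close>
  define \<sigma> where "\<sigma> x = (if x < k then f x else if x < n then g x else x)" for x
  have "bij_betw \<sigma> {..<k} S" using f by (rule bij_betw_cong[THEN iffD1, rotated]) (simp add: \<sigma>_def)
  moreover have "bij_betw \<sigma> {k..<n} ({..<n} - S)"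
    using g by (rule bij_betw_cong[THEN iffD1, rotated]) (simp add: \<sigma>_def)
  ultimately have "bij_betw \<sigma> ({..<k} \<union> {k..<n}) (S \<union> ({..<n} - S))"
    by (rule bij_betw_combine) auto
  moreover have "{..<k} \<union> {k..<n} = {..<n}" using k by auto
  moreover have "S \<union> ({..<n} - S) = {..<n}" using S(1) by auto
  ultimately have \<sigma>: "\<sigma> permutes {..<n}"
    by (intro bij_imp_permutes) (use k in \<open>auto simp: \<sigma>_def\<close>)
  have \<sigma>_in: "\<sigma> x \<in> S" if "x < k" for x
    using bij_betw_apply[OF f, of x] that by (simp add: \<sigma>_def)
  have \<sigma>_out: "\<sigma> x < n \<and> \<sigma> x \<notin> S" if "\<not> x < k" "x < n" for x
    using bij_betw_apply[OF g, of x] that by (simp add: \<sigma>_def)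
  let ?P = "mat n n (\<lambda>(i, j). if i = \<sigma> j then 1 else 0) :: 'a mat"
  \<comment> \<open>\<open>?B r c a b\<close> is the r by c submatrix of the relabelled matrix whose
    top left corner is at \<open>(a, b)\<close>.\<close>
  let ?B = "\<lambda>r c a b. mat r c (\<lambda>(i, j). A $$ (\<sigma> (i + a), \<sigma> (j + b)))"
  have block: "?P\<^sup>T * A * ?P =
      four_block_mat (?B k k 0 0) (0\<^sub>m k (n - k)) (?B (n - k) k k 0) (?B (n - k) (n - k) k k)"
    unfolding permutation_mat_conj[OF \<sigma> A refl]
    by (rule eq_matI) (use k in \<open>auto simp: zero[OF \<sigma>_in] \<sigma>_out\<close>)
  have perm: "permutation_mat n ?P" unfolding permutation_mat_def using \<sigma> by blast
  show ?thesis unfolding reducible_mat_def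
    by (intro exI conjI) (rule A perm k mat_carrier block)+
qed

text \<open>Maximum principle: in a row where \<open>v\<close> attains its maximum \<open>M\<close>,
  a weighted average of values at most \<open>M\<close> equals \<open>M\<close>, so no weight falls
  on smaller values. The set of maximal coordinates would therefore reduce \<open>A\<close> if it
  were proper.\<close>

lemma irreducible_fixed_vec_const:
  assumes A: "A \<in> carrier_mat n n" and ds: "doubly_stochastic A" and irr: "irreducible_mat A"
    and v: "v \<in> carrier_vec n" and fixed: "A *\<^sub>v v = v" and ij: "i < n" "j < n"
  shows "v $ i = v $ j"
proof -
  note ds = doubly_stochasticD[OF ds A]
  define M where "M = Max ((\<lambda>i. v $ i) ` {..<n})"
  define S where "S = {i. i < n \<and> v $ i = M}"
  have le: "v $ k \<le> M" if "k < n" for k using that unfolding M_def by (intro Max_ge) auto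
  have "M \<in> (\<lambda>i. v $ i) ` {..<n}" unfolding M_def using ij by (intro Max_in) auto
  hence "S \<noteq> {}" by (auto simp: S_def)
  have "A $$ (k, l) = 0" if k: "k \<in> S" and l: "l < n" "l \<notin> S" for k l
  proof -
    \<comment> \<open>The deficits \<open>M - v $ j\<close>, weighted by row \<open>k\<close>, are
      nonnegative and add up to zero, so each weighted deficit is zero.\<close>
    have kn: "k < n" and vk: "v $ k = M" using k by (auto simp: S_def)
    have "(\<Sum>j<n. A $$ (k, j) * (M - v $ j)) = (\<Sum>j<n. A $$ (k, j)) * M - (A *\<^sub>v v) $ k"
      unfolding mult_mat_vec_index_sum[OF A v kn]
      by (simp add: right_diff_distrib sum_subtractf sum_distrib_right)
    also have "\<dots> = 0" unfolding fixed vk ds(2)[OF kn] by simp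
    finally have "A $$ (k, l) * (M - v $ l) = 0"
      by (rule sum_nonneg_0[rotated 2]) (use l ds(1)[OF kn] le in auto)
    moreover have "v $ l \<noteq> M" using l by (simp add: S_def)
    ultimately show ?thesis by simp
  qed
  hence "\<not> S \<subset> {..<n}"
    using reducible_matI[OF A _ \<open>S \<noteq> {}\<close>] irr unfolding irreducible_mat_def by blast
  hence "S = {..<n}" by (auto simp: S_def)
  hence "i \<in> S" "j \<in> S" using ij by auto
  thus ?thesis by (simp add: S_def)
qed

text \<open>As \<open>A\<close> is real, the real and imaginary parts of a fixed vector are
  themselves fixed, and the real case applies to each.\<close>

lemma irreducible_fixed_vec_const_complex:
  assumes A: "A \<in> carrier_mat n n" and ds: "doubly_stochastic A" and irr: "irreducible_mat A"
    and v: "v \<in> carrier_vec n" and fixed: "map_mat complex_of_real A *\<^sub>v v = v"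
    and ij: "i < n" "j < n"
  shows "v $ i = v $ j"
proof -
  have dim: "dim_vec v = n" using v by simp
  have eq: "v $ k = (\<Sum>j<n. complex_of_real (A $$ (k, j)) * v $ j)" if "k < n" for k
    using mult_mat_vec_index_sum[of "map_mat complex_of_real A" n v k] A v that
    unfolding fixed by simp
  have "A *\<^sub>v map_vec Re v = map_vec Re v"
  proof (rule eq_vecI)
    fix k assume "k < dim_vec (map_vec Re v)"
    hence k: "k < n" using v by simp
    have "(A *\<^sub>v map_vec Re v) $ k = (\<Sum>j<n. A $$ (k, j) * Re (v $ j))"
      using A v k by (subst mult_mat_vec_index_sum[of _ n]) auto
    also have "\<dots> = Re (v $ k)" unfolding eq[OF k] by simp
    finally show "(A *\<^sub>v map_vec Re v) $ k = map_vec Re v $ k" using v k by simp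
  qed (use A v in auto)
  hence "map_vec Re v $ i = map_vec Re v $ j"
    by (rule irreducible_fixed_vec_const[OF A ds irr map_carrier_vec[THEN iffD2, OF v] _ ij])
  hence Re: "Re (v $ i) = Re (v $ j)"
    unfolding index_map_vec(1)[OF ij(1)[folded dim]] index_map_vec(1)[OF ij(2)[folded dim]] .
  have "A *\<^sub>v map_vec Im v = map_vec Im v"
  proof (rule eq_vecI)
    fix k assume "k < dim_vec (map_vec Im v)"
    hence k: "k < n" using v by simp
    have "(A *\<^sub>v map_vec Im v) $ k = (\<Sum>j<n. A $$ (k, j) * Im (v $ j))"
      using A v k by (subst mult_mat_vec_index_sum[of _ n]) auto
    also have "\<dots> = Im (v $ k)" unfolding eq[OF k] by simp
    finally show "(A *\<^sub>v map_vec Im v) $ k = map_vec Im v $ k" using v k by simp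
  qed (use A v in auto)
  hence "map_vec Im v $ i = map_vec Im v $ j"
    by (rule irreducible_fixed_vec_const[OF A ds irr map_carrier_vec[THEN iffD2, OF v] _ ij])
  hence Im: "Im (v $ i) = Im (v $ j)"
    unfolding index_map_vec(1)[OF ij(1)[folded dim]] index_map_vec(1)[OF ij(2)[folded dim]] .
  from Re Im show ?thesis by (rule complex_eqI)
qed

section \<open>Spectrum of doubly stochastic matrices\<close>

text \<open>Row sums give \<open>A * J_mat n = J_mat n\<close> and column sums give
  \<open>J_mat n * A = J_mat n\<close>. The matrix \<open>J_mat n\<close> replaces each coordinate
  by the mean, so it fixes the constant vectors, and by the maximum principle these include all
  fixed vectors of \<open>A\<close>.\<close>

lemma absorbing_pair_irreducible:
  assumes A: "A \<in> carrier_mat n n" and ds: "doubly_stochastic A" and irr: "irreducible_mat A"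
  shows "absorbing_pair n (map_mat complex_of_real A) (map_mat complex_of_real (J_mat n))"
proof -
  note ds' = doubly_stochasticD[OF ds A]
  have J: "J_mat n \<in> carrier_mat n n" by (simp add: J_mat_def)
  have "A * J_mat n = J_mat n"
  proof (rule eq_matI)
    fix i j assume "i < dim_row (J_mat n)" "j < dim_col (J_mat n)"
    hence "i < n" "j < n" using J by auto
    thus "(A * J_mat n) $$ (i, j) = J_mat n $$ (i, j)"
      using A ds'(2)[of i] by (simp add: J_mat_def scalar_prod_def atLeast0LessThan flip: sum_divide_distrib)
  qed (use A J in auto)
  moreover have "J_mat n * A = J_mat n"
  proof (rule eq_matI)
    fix i j assume "i < dim_row (J_mat n)" "j < dim_col (J_mat n)"
    hence "i < n" "j < n" using J by auto
    thus "(J_mat n * A) $$ (i, j) = J_mat n $$ (i, j)"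
      using A ds'(3)[of j] by (simp add: J_mat_def scalar_prod_def atLeast0LessThan flip: sum_divide_distrib)
  qed (use A J in auto)
  moreover have "map_mat complex_of_real (J_mat n) *\<^sub>v v = v"
    if v: "v \<in> carrier_vec n" and fixed: "map_mat complex_of_real A *\<^sub>v v = v" for v
  proof (rule eq_vecI)
    fix i assume "i < dim_vec v"
    hence i: "i < n" using v by simp
    have "(map_mat complex_of_real (J_mat n) *\<^sub>v v) $ i = (\<Sum>j<n. 1 / of_nat n * v $ j)"
      using v J i by (simp add: scalar_prod_def atLeast0LessThan J_mat_def)
    also have "\<dots> = (\<Sum>j<n. 1 / of_nat n * v $ i)"
    proof (rule sum.cong)
      fix j assume "j \<in> {..<n}"
      hence "v $ j = v $ i"
        by (intro irreducible_fixed_vec_const_complex[OF A ds irr v fixed _ i]) simp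
      thus "1 / of_nat n * v $ j = 1 / of_nat n * v $ i" by simp
    qed simp
    also have "\<dots> = v $ i" using i by simp
    finally show "(map_mat complex_of_real (J_mat n) *\<^sub>v v) $ i = v $ i" .
  qed (use J v in auto)
  ultimately show ?thesis unfolding absorbing_pair_def
    using A J of_real_hom.mat_hom_mult[OF A J, where 'a = complex]
      of_real_hom.mat_hom_mult[OF J A, where 'a = complex] by simp
qed

lemma eigenvalue_doubly_stochastic_1:
  assumes A: "A \<in> carrier_mat n n" and ds: "doubly_stochastic A" and n: "0 < n"
  shows "eigenvalue (map_mat complex_of_real A) 1"
proof -
  let ?v = "vec n (\<lambda>_. 1) :: complex vec"
  have "map_mat complex_of_real A *\<^sub>v ?v = ?v"
    using A doubly_stochasticD(2)[OF ds A]
    by (intro eq_vecI) (auto simp: scalar_prod_def atLeast0LessThan simp flip: of_real_sum)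
  moreover have "?v $ 0 \<noteq> (0\<^sub>v n) $ 0" using n by simp
  hence "?v \<noteq> 0\<^sub>v n" by metis
  ultimately show ?thesis unfolding eigenvalue_def eigenvector_def
    using A by (intro exI[of _ ?v]) simp
qed

text \<open>At a coordinate where the eigenvector has maximal modulus \<open>M\<close>, the
  eigenvalue equation bounds \<open>cmod z * M\<close> by a convex combination of moduli that are at
  most \<open>M\<close>.\<close>

lemma eigenvalue_doubly_stochastic_le_1:
  assumes A: "A \<in> carrier_mat n n" and ds: "doubly_stochastic A"
    and z: "eigenvalue (map_mat complex_of_real A) z"
  shows "cmod z \<le> 1"
proof -
  note ds = doubly_stochasticD[OF ds A]
  have C: "map_mat complex_of_real A \<in> carrier_mat n n" using A by simp
  from z obtain v where v: "v \<in> carrier_vec n" "v \<noteq> 0\<^sub>v n"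
    and zv: "map_mat complex_of_real A *\<^sub>v v = z \<cdot>\<^sub>v v"
    unfolding eigenvalue_def eigenvector_def using A by auto
  obtain k where k: "k < n" "v $ k \<noteq> 0" using v by (metis carrier_vecD eq_vecI index_zero_vec)
  define M where "M = Max ((\<lambda>i. cmod (v $ i)) ` {..<n})"
  have le: "cmod (v $ i) \<le> M" if "i < n" for i
    using that unfolding M_def by (intro Max_ge) auto
  have "M \<in> (\<lambda>i. cmod (v $ i)) ` {..<n}" unfolding M_def using k by (intro Max_in) auto
  then obtain i where i: "i < n" "M = cmod (v $ i)" by auto
  have "0 < cmod (v $ k)" using k by simp
  hence M: "0 < M" using le[OF k(1)] by linarith
  have "cmod z * M = cmod ((z \<cdot>\<^sub>v v) $ i)" using i v by (simp add: norm_mult)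
  also have "\<dots> = cmod (\<Sum>j<n. A $$ (i, j) * v $ j)"
    unfolding zv[symmetric] using mult_mat_vec_index_sum[OF C v(1) i(1)] A i by simp
  also have "\<dots> \<le> (\<Sum>j<n. A $$ (i, j) * M)"
    using ds(1)[OF i(1)] le by (intro sum_norm_le) (auto simp: norm_mult intro!: mult_left_mono)
  also have "\<dots> = M" using ds(2)[OF i(1)] by (simp flip: sum_distrib_right)
  finally show ?thesis using M by simp
qed

text \<open>If \<open>1\<close> had multiplicity at least two there would be \<open>q\<close> with \<open>A q = t p + q\<close> for a constant
  vector \<open>p\<close>; since \<open>A\<close> preserves coordinate sums, \<open>t = 0\<close>, and then \<open>q\<close> is constant as well.\<close>

lemma order_char_poly_irreducible:
  assumes A: "A \<in> carrier_mat n n" and ds: "doubly_stochastic A" and irr: "irreducible_mat A"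
    and n: "0 < n"
  shows "Polynomial.order 1 (char_poly (map_mat complex_of_real A)) = 1"
proof -
  let ?C = "map_mat complex_of_real A"
  have C: "?C \<in> carrier_mat n n" using A by simp
  have "poly (char_poly ?C) 1 = 0"
    using eigenvalue_doubly_stochastic_1[OF A ds n] eigenvalue_root_char_poly[OF C] by simp
  moreover have "char_poly ?C \<noteq> 0" using degree_monic_char_poly[OF C] by auto
  ultimately have "Polynomial.order 1 (char_poly ?C) \<noteq> 0" using order_root by blast
  moreover have "\<not> 2 \<le> Polynomial.order 1 (char_poly ?C)"
  proof
    assume "2 \<le> Polynomial.order 1 (char_poly ?C)"
    then obtain p q t where pqt: "p \<in> carrier_vec n" "q \<in> carrier_vec n" "p \<noteq> 0\<^sub>v n"
      "?C *\<^sub>v p = 1 \<cdot>\<^sub>v p" "?C *\<^sub>v q = t \<cdot>\<^sub>v p + 1 \<cdot>\<^sub>v q" and indep: "\<And>c. q \<noteq> c \<cdot>\<^sub>v p"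
      by (rule order_char_poly_ge_2E[OF C]) blast
    note p = pqt(1,3) pqt(4)[unfolded one_smult_vec] and q = pqt(2)
      and Cq = pqt(5)[unfolded one_smult_vec]
    have const_p: "p $ i = p $ 0" if "i < n" for i
      by (rule irreducible_fixed_vec_const_complex[OF A ds irr p(1,3) that n])
    have p0: "p $ 0 \<noteq> 0"
    proof
      assume "p $ 0 = 0"
      have "p = 0\<^sub>v n"
      proof (rule eq_vecI)
        fix i assume "i < dim_vec (0\<^sub>v n)"
        thus "p $ i = 0\<^sub>v n $ i" using const_p[of i] \<open>p $ 0 = 0\<close> by simp
      qed (use p(1) in simp)
      with p(2) show False by simp
    qed
    have "(\<Sum>i<n. (?C *\<^sub>v q) $ i) = (\<Sum>i<n. \<Sum>j<n. complex_of_real (A $$ (i, j)) * q $ j)"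
      using mult_mat_vec_index_sum[OF C q] A by (intro sum.cong) auto
    also have "\<dots> = (\<Sum>j<n. complex_of_real (\<Sum>i<n. A $$ (i, j)) * q $ j)"
      by (subst sum.swap) (simp add: sum_distrib_right)
    also have "\<dots> = (\<Sum>j<n. q $ j)" using doubly_stochasticD(3)[OF ds A] by simp
    finally have "(\<Sum>i<n. t * p $ i + q $ i) = (\<Sum>j<n. q $ j)" unfolding Cq using p q by simp
    hence "(\<Sum>i<n. t * p $ i) = 0" by (simp add: sum.distrib)
    moreover have "(\<Sum>i<n. t * p $ i) = (\<Sum>i<n. t * p $ 0)"
    proof (rule sum.cong)
      fix i assume "i \<in> {..<n}"
      thus "t * p $ i = t * p $ 0" using const_p[of i] by simp
    qed simp
    ultimately have "t = 0" using n p0 by simp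
    hence "?C *\<^sub>v q = q" using Cq p q by (intro eq_vecI) auto
    hence const_q: "q $ i = q $ 0" if "i < n" for i
      using irreducible_fixed_vec_const_complex[OF A ds irr q _ that n] by simp
    \<comment> \<open>Both vectors are constant and \<open>p $ 0\<close> is nonzero, so
      \<open>q\<close> is a multiple of \<open>p\<close>, against their independence.\<close>
    have "q = (q $ 0 / p $ 0) \<cdot>\<^sub>v p"
    proof (rule eq_vecI)
      fix i assume "i < dim_vec ((q $ 0 / p $ 0) \<cdot>\<^sub>v p)"
      hence "i < n" using p(1) by simp
      with const_p[OF this] const_q[OF this] p0 p(1)
      show "q $ i = ((q $ 0 / p $ 0) \<cdot>\<^sub>v p) $ i" by simp
    qed (use p q in auto)
    with indep show False by blast
  qed
  ultimately show ?thesis by simp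
qed

section \<open>Block-diagonal direct sums\<close>

lemma map_mat_diag_block_mat:
  assumes "f 0 = 0"
  shows "map_mat f (diag_block_mat As) = diag_block_mat (map (map_mat f) As)"
proof (induct As)
  case (Cons A As)
  have "map_mat f (diag_block_mat (A # As)) = four_block_mat (map_mat f A)
    (0\<^sub>m (dim_row A) (dim_col (diag_block_mat As))) (0\<^sub>m (dim_row (diag_block_mat As)) (dim_col A))
    (map_mat f (diag_block_mat As))"
    by (rule eq_matI) (auto simp: Let_def assms)
  thus ?case by (simp add: Let_def flip: Cons)
next
  case Nil
  show ?case by (rule eq_matI) auto
qed

lemma diag_block_mat_carrier:
  assumes "\<And>A. A \<in> set As \<Longrightarrow> square_mat A"
  shows "diag_block_mat As \<in> carrier_mat (sum_list (map dim_row As)) (sum_list (map dim_row As))"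
proof (rule carrier_matI)
  show "dim_row (diag_block_mat As) = sum_list (map dim_row As)" by (rule dim_diag_block_mat)
  moreover have "square_mat (diag_block_mat As)"
    by (rule diag_block_mat_square) (use assms in blast)
  ultimately show "dim_col (diag_block_mat As) = sum_list (map dim_row As)" by simp
qed

lemma absorbing_pair_diag_block:
  assumes "\<And>A. A \<in> set As \<Longrightarrow> absorbing_pair (dim_row A) A (K A)"
  shows "absorbing_pair (sum_list (map dim_row As)) (diag_block_mat As) (diag_block_mat (map K As))"
  using assms
proof (induct As)
  case Nil
  show ?case by (auto simp: absorbing_pair_def)
next
  case (Cons A As)
  let ?n = "dim_row A" and ?m = "sum_list (map dim_row As)"
  have 1: "absorbing_pair ?n A (K A)"
    and 2: "absorbing_pair ?m (diag_block_mat As) (diag_block_mat (map K As))"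
    using Cons by auto
  from 1 have "dim_col A = ?n" "dim_row (K A) = ?n" "dim_col (K A) = ?n"
    unfolding absorbing_pair_def by auto
  moreover from 2 have "dim_row (diag_block_mat As) = ?m" "dim_col (diag_block_mat As) = ?m"
    "dim_row (diag_block_mat (map K As)) = ?m" "dim_col (diag_block_mat (map K As)) = ?m"
    unfolding absorbing_pair_def by auto
  ultimately show ?case using absorbing_pair_four_block[OF 1 2] by (simp add: Let_def)
qed

text \<open>The characteristic polynomial of a direct sum is the product over the blocks, and the
  order of a root is additive over nonzero factors.\<close>

lemma order_char_poly_diag_block:
  fixes As :: "complex mat list"
  assumes "\<And>A. A \<in> set As \<Longrightarrow> square_mat A"
  shows "Polynomial.order z (char_poly (diag_block_mat As)) = (\<Sum>A\<leftarrow>As. Polynomial.order z (char_poly A))"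
  using assms
proof (induct As)
  case Nil
  \<comment> \<open>The empty direct sum is the 0 by 0 matrix. Its characteristic polynomial is 1,
    which has no roots and so matches the empty sum.\<close>
  have "char_poly (0\<^sub>m 0 0 :: complex mat) = 1"
    by (rule monic_degree_0[THEN iffD1]) (use degree_monic_char_poly[of "0\<^sub>m 0 0 :: complex mat" 0] in simp_all)
  thus ?case by (simp add: order_0I)
next
  case (Cons A As)
  let ?B = "diag_block_mat As"
  define n m where "n = dim_row A" and "m = sum_list (map dim_row As)"
  have A: "A \<in> carrier_mat n n" using Cons.prems[of A] by (auto simp: n_def)
  have B: "?B \<in> carrier_mat m m" unfolding m_def by (rule diag_block_mat_carrier) (use Cons.prems in auto)
  have nz: "char_poly A \<noteq> 0" "char_poly ?B \<noteq> 0"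
    using degree_monic_char_poly[OF A] degree_monic_char_poly[OF B] by auto
  have "char_poly (four_block_mat A (0\<^sub>m n m) (0\<^sub>m m n) ?B) = char_poly A * char_poly ?B"
    using char_poly_factorized[OF A] char_poly_factorized[OF B]
    by (intro char_poly_0_block'[OF refl _ _ A zero_carrier_mat B]) blast+
  moreover have "diag_block_mat (A # As) = four_block_mat A (0\<^sub>m n m) (0\<^sub>m m n) ?B"
    using A B by (simp add: Let_def)
  ultimately show ?case using Cons.hyps Cons.prems order_mult[of "char_poly A" "char_poly ?B" z] nz
    by simp
qed

section \<open>The peripheral spectrum and its effect on convergence of powers\<close>

lemma spectral_radius_doubly_stochastic:
  assumes A: "A \<in> carrier_mat n n" and ds: "doubly_stochastic A" and n: "0 < n"
  shows "spectral_radius (map_mat complex_of_real A) = 1"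
proof (rule antisym)
  have C: "map_mat complex_of_real A \<in> carrier_mat n n" using A by simp
  show "spectral_radius (map_mat complex_of_real A) \<le> 1"
    using spectral_radius_mem_max(1)[OF C n] eigenvalue_doubly_stochastic_le_1[OF A ds]
    unfolding spectrum_def by auto
  have "norm (1 :: complex) \<in> norm ` spectrum (map_mat complex_of_real A)"
    using eigenvalue_doubly_stochastic_1[OF A ds n] unfolding spectrum_def by blast
  from spectral_radius_mem_max(2)[OF C n this]
  show "1 \<le> spectral_radius (map_mat complex_of_real A)" by simp
qed

text \<open>The spectral radius is 1, so the peripheral count is the multiplicity of 1 plus the
  multiplicities of the other eigenvalues of modulus 1. These are positive, so equality holds
  exactly when there are no such eigenvalues.\<close>

lemma peripheral_count_eq_multiplicity_1_iff:
  assumes A: "A \<in> carrier_mat n n" and ds: "doubly_stochastic A" and n: "0 < n"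
  defines "C \<equiv> map_mat complex_of_real A"
  shows "eigenvalue_multiplicity C 1 = peripheral_count C \<longleftrightarrow>
    (\<forall>z. eigenvalue C z \<longrightarrow> cmod z < 1 \<or> z = 1)"
proof -
  have C: "C \<in> carrier_mat n n" using A by (simp add: C_def)
  define S where "S = {z \<in> spectrum C. cmod z = 1}"
  have count: "peripheral_count C = (\<Sum>z\<in>S. eigenvalue_multiplicity C z)"
    unfolding peripheral_count_def S_def C_def spectral_radius_doubly_stochastic[OF A ds n] ..
  have fin: "finite S" using card_finite_spectrum(1)[OF C] by (simp add: S_def)
  have 1: "1 \<in> S" using eigenvalue_doubly_stochastic_1[OF A ds n]
    by (simp add: S_def spectrum_def C_def)
  have "char_poly C \<noteq> 0" using degree_monic_char_poly[OF C] by auto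
  hence pos: "eigenvalue_multiplicity C z > 0" if "z \<in> S" for z
    using that spectrum_root_char_poly[OF C] order_root[of "char_poly C" z]
    by (auto simp: S_def eigenvalue_multiplicity_def)
  have "peripheral_count C =
      eigenvalue_multiplicity C 1 + (\<Sum>z\<in>S - {1}. eigenvalue_multiplicity C z)"
    unfolding count using sum.remove[OF fin 1] .
  hence "eigenvalue_multiplicity C 1 = peripheral_count C \<longleftrightarrow>
      (\<Sum>z\<in>S - {1}. eigenvalue_multiplicity C z) = 0" by simp
  also have "\<dots> \<longleftrightarrow> S - {1} = {}"
  proof
    assume "(\<Sum>z\<in>S - {1}. eigenvalue_multiplicity C z) = 0"
    hence "\<forall>z\<in>S - {1}. eigenvalue_multiplicity C z = 0" using fin by simp
    thus "S - {1} = {}" using pos by (metis DiffD1 equals0I less_irrefl)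
  next
    assume "S - {1} = {}"
    thus "(\<Sum>z\<in>S - {1}. eigenvalue_multiplicity C z) = 0" by (simp only: sum.empty)
  qed
  also have "\<dots> \<longleftrightarrow> (\<forall>z. eigenvalue C z \<longrightarrow> cmod z < 1 \<or> z = 1)"
    using eigenvalue_doubly_stochastic_le_1[OF A ds]
    unfolding S_def C_def spectrum_def by force
  finally show ?thesis .
qed

text \<open>Reading off a nonzero coordinate of an eigenvector turns convergence of the matrix
  powers into convergence of the powers of \<open>z\<close>. Their consecutive differences then tend
  to zero, yet on the unit circle each has modulus \<open>cmod (z - 1)\<close>.\<close>

lemma peripheral_eigenvalue_pow_convergent:
  fixes C :: "complex mat"
  assumes C: "C \<in> carrier_mat n n"
    and conv: "\<And>i j. i < n \<Longrightarrow> j < n \<Longrightarrow> (\<lambda>m. (C ^\<^sub>m m) $$ (i, j)) \<longlonglongrightarrow> L i j"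
    and z: "eigenvalue C z" "cmod z = 1"
  shows "z = 1"
proof -
  from z(1) obtain v where ev: "eigenvector C v z" unfolding eigenvalue_def by auto
  hence v: "v \<in> carrier_vec n" "v \<noteq> 0\<^sub>v n" unfolding eigenvector_def using C by auto
  obtain i where i: "i < n" "v $ i \<noteq> 0" using v by (metis carrier_vecD eq_vecI index_zero_vec)
  have "z ^ m * v $ i = (\<Sum>j<n. (C ^\<^sub>m m) $$ (i, j) * v $ j)" for m
  proof -
    have Cm: "C ^\<^sub>m m \<in> carrier_mat n n" using C by simp
    have "z ^ m * v $ i = (C ^\<^sub>m m *\<^sub>v v) $ i"
      unfolding eigenvector_pow[OF C ev] using i v by simp
    thus ?thesis unfolding mult_mat_vec_index_sum[OF Cm v(1) i(1)] .
  qed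
  moreover have "(\<lambda>m. \<Sum>j<n. (C ^\<^sub>m m) $$ (i, j) * v $ j) \<longlonglongrightarrow> (\<Sum>j<n. L i j * v $ j)"
    using conv[OF i(1)] by (intro tendsto_sum tendsto_mult) auto
  ultimately have "(\<lambda>m. z ^ m * v $ i) \<longlonglongrightarrow> (\<Sum>j<n. L i j * v $ j)" by simp
  from tendsto_divide[OF this tendsto_const[of "v $ i"] i(2)]
  obtain l where l: "(\<lambda>m. z ^ m) \<longlonglongrightarrow> l" using i(2) by auto
  have "(\<lambda>m. cmod (z ^ Suc m - z ^ m)) \<longlonglongrightarrow> cmod (l - l)"
    by (intro tendsto_intros l LIMSEQ_Suc)
  moreover have "cmod (z ^ Suc m - z ^ m) = cmod (z - 1)" for m
  proof -
    have "z ^ Suc m - z ^ m = z ^ m * (z - 1)" by (simp add: algebra_simps)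
    thus ?thesis using z(2) by (simp only: norm_mult norm_power) simp
  qed
  ultimately have "(\<lambda>m :: nat. cmod (z - 1)) \<longlonglongrightarrow> 0" by simp
  thus ?thesis by (simp add: LIMSEQ_const_iff)
qed

section \<open>Assembly of the convergence criterion and the limit\<close>

lemma conj_eq_imp_eq_conj:
  fixes P :: "'a :: field mat"
  assumes "P \<in> carrier_mat n n" "Q \<in> carrier_mat n n" "D \<in> carrier_mat n n"
    and "P * Q = 1\<^sub>m n" and "Q * D * P = B"
  shows "D = P * B * Q"
proof -
  have "P * B * Q = (P * Q) * D * (P * Q)"
    unfolding assms(5)[symmetric] using assms(1-3) by (simp add: assoc_mult_mat[of _ n n _ n _ n])
  thus ?thesis using assms(3) unfolding assms(4) by simp
qed

theorem theorem4p13: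
  fixes n h :: nat and D P :: "real mat" and Ds :: "real mat list"
  assumes "0 < n"
    and "D \<in> carrier_mat n n" and "doubly_stochastic D"
    and "h = peripheral_count (map_mat complex_of_real D)"
    and "permutation_mat n P"
    and "P\<^sup>T * D * P = diag_block_mat Ds"
    and "\<forall>A\<in>set Ds. 0 < dim_row A \<and> doubly_stochastic A \<and> irreducible_mat A"
  shows "((\<exists>L. mat_tendsto (\<lambda>m. D ^\<^sub>m m) L) \<longleftrightarrow>
           eigenvalue_multiplicity (map_mat complex_of_real D) 1 = h) \<and>
         ((\<exists>L. mat_tendsto (\<lambda>m. D ^\<^sub>m m) L) \<longrightarrow>
           length Ds = h \<and>
           mat_tendsto (\<lambda>m. D ^\<^sub>m m)
             (P * diag_block_mat (map (\<lambda>A. J_mat (dim_row A)) Ds) * P\<^sup>T))"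
proof -
  note D = assms(2) and ds = assms(3)
  \<comment> \<open>Eigenvalues live over the complex numbers, so the relations between
    \<open>D\<close> and the proposed limit are established for the embedded matrices.\<close>
  define C where "C = map_mat complex_of_real D"
  define J where "J = diag_block_mat (map (\<lambda>A. J_mat (dim_row A)) Ds)"
  define B where "B = diag_block_mat Ds"
  let ?E = "P * J * P\<^sup>T"
  let ?c = "map_mat complex_of_real"
  note P = permutation_mat_orthogonal[OF assms(5)]
  have PT: "P\<^sup>T \<in> carrier_mat n n" using P(1) by simp
  have C: "C \<in> carrier_mat n n" using D by (simp add: C_def)
  have block: "A \<in> carrier_mat (dim_row A) (dim_row A)" "0 < dim_row A" "doubly_stochastic A"
    "irreducible_mat A" if "A \<in> set Ds" for A
    using assms(7) that unfolding doubly_stochastic_def by auto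
  have B: "B \<in> carrier_mat n n" unfolding B_def assms(6)[symmetric] using P(1) PT D by simp
  have dims: "sum_list (map dim_row Ds) = n"
    using B dim_diag_block_mat(1)[of Ds] unfolding B_def by simp
  have DB: "D = P * B * P\<^sup>T"
    by (rule conj_eq_imp_eq_conj[OF P(1) PT D P(3)]) (simp add: B_def assms(6))
  have cB: "?c B = diag_block_mat (map ?c Ds)"
    unfolding B_def by (rule map_mat_diag_block_mat) simp
  have "?c J = diag_block_mat (map (\<lambda>A. ?c (J_mat (dim_row A))) Ds)"
    unfolding J_def by (subst map_mat_diag_block_mat) (simp_all add: comp_def)
  \<comment> \<open>Embedding keeps the number of rows, so the averaging blocks can be indexed by
    the embedded list; this is the form that \<open>absorbing_pair_diag_block\<close>
    produces.\<close>
  hence cJ: "?c J = diag_block_mat (map (\<lambda>A. ?c (J_mat (dim_row A))) (map ?c Ds))"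
    by (simp add: comp_def)
  have "absorbing_pair (dim_row A) A (?c (J_mat (dim_row A)))" if "A \<in> set (map ?c Ds)" for A
    using that absorbing_pair_irreducible[OF block(1,3,4)] by auto
  from absorbing_pair_diag_block[of "map ?c Ds", OF this]
  have abs_B: "absorbing_pair n (?c B) (?c J)"
    unfolding cB cJ using dims by (simp add: comp_def)
  hence J: "J \<in> carrier_mat n n" unfolding absorbing_pair_def by simp
  have conj: "?c (P * X * P\<^sup>T) = ?c P * ?c X * ?c P\<^sup>T" if "X \<in> carrier_mat n n" for X
    using P(1) PT that by (simp add: of_real_hom.mat_hom_mult[of _ n n _ n])
  have P': "?c P \<in> carrier_mat n n" "?c P\<^sup>T \<in> carrier_mat n n" "?c P\<^sup>T * ?c P = 1\<^sub>m n"
    "?c P * ?c P\<^sup>T = 1\<^sub>m n"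
    using P PT by (simp_all add: of_real_hom.mat_hom_mult[of _ n n _ n, symmetric] of_real_hom.mat_hom_one)
  have CB: "C = ?c P * ?c B * ?c P\<^sup>T" unfolding C_def DB by (rule conj[OF B])
  have abs_C: "absorbing_pair n C (?c ?E)"
    unfolding CB conj[OF J] by (rule absorbing_pair_similar[OF abs_B P'])
  \<comment> \<open>Similarity preserves the characteristic polynomial, and each irreducible block
    contributes the root 1 exactly once, so the multiplicity of 1 counts the blocks.\<close>
  have "similar_mat C (?c B)"
    by (rule similar_matI[OF _ P'(4,3) CB]) (use C B P' in auto)
  hence "eigenvalue_multiplicity C 1 = Polynomial.order 1 (char_poly (diag_block_mat (map ?c Ds)))"
    unfolding eigenvalue_multiplicity_def cB[symmetric] by (simp add: char_poly_similar)
  also have "\<dots> = (\<Sum>A\<leftarrow>map ?c Ds. Polynomial.order 1 (char_poly A))"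
    by (rule order_char_poly_diag_block) (use assms(7) in \<open>auto simp: doubly_stochastic_def\<close>)
  also have "\<dots> = (\<Sum>A\<leftarrow>Ds. 1)"
    unfolding map_map comp_def
    by (intro arg_cong[of _ _ sum_list] map_cong refl order_char_poly_irreducible[OF block(1,3,4,2)])
  finally have mult_1: "eigenvalue_multiplicity C 1 = length Ds" by (simp add: sum_list_triv)
  have pow: "(C ^\<^sub>m m) $$ (i, j) = complex_of_real ((D ^\<^sub>m m) $$ (i, j))" if "i < n" "j < n" for m i j
    unfolding C_def of_real_hom.mat_hom_pow[OF D, symmetric] using that D by simp
  \<comment> \<open>This spectral condition is the middle term: the multiplicity statement and the
    existence of a limit are each shown equivalent to it.\<close>
  define peripheral where "peripheral \<longleftrightarrow> (\<forall>z. eigenvalue C z \<longrightarrow> cmod z < 1 \<or> z = 1)"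
  have iff: "eigenvalue_multiplicity C 1 = h \<longleftrightarrow> peripheral"
    unfolding peripheral_def assms(4) C_def
    by (rule peripheral_count_eq_multiplicity_1_iff[OF D ds assms(1)])
  have lim: "mat_tendsto (\<lambda>m. D ^\<^sub>m m) ?E" if peripheral
  proof -
    have E: "?E \<in> carrier_mat n n" using P(1) PT J by simp
    have "(\<lambda>m. (D ^\<^sub>m m) $$ (i, j)) \<longlonglongrightarrow> ?E $$ (i, j)" if ij: "i < n" "j < n" for i j
    proof -
      have "(\<lambda>m. (C ^\<^sub>m m) $$ (i, j)) \<longlonglongrightarrow> ?c ?E $$ (i, j)"
        by (rule absorbing_pair_pow_tendsto[OF abs_C _ ij]) (use \<open>peripheral\<close> in \<open>simp add: peripheral_def\<close>)
      moreover have "?c ?E $$ (i, j) = complex_of_real (?E $$ (i, j))"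
        using E ij by (intro index_map_mat(1)) (simp_all only: carrier_matD)
      ultimately show ?thesis unfolding pow[OF ij] by (simp only: tendsto_of_real_iff)
    qed
    moreover have "D ^\<^sub>m m \<in> carrier_mat n n" for m using D by simp
    ultimately show ?thesis unfolding mat_tendsto_def carrier_matD[OF E] by blast
  qed
  have peripheral if "mat_tendsto (\<lambda>m. D ^\<^sub>m m) L" for L
    unfolding peripheral_def
  proof (intro allI impI)
    fix z assume z: "eigenvalue C z"
    \<comment> \<open>An arbitrary limit \<open>L\<close> comes without a stated format; the zeroth
      power, an n by n identity, determines it.\<close>
    have "D ^\<^sub>m 0 \<in> carrier_mat (dim_row L) (dim_col L)"
      using that unfolding mat_tendsto_def by blast
    hence dim_L: "dim_row L = n" "dim_col L = n" using D by auto
    have "(\<lambda>m. (D ^\<^sub>m m) $$ (i, j)) \<longlonglongrightarrow> L $$ (i, j)" if "i < n" "j < n" for i j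
      using \<open>mat_tendsto (\<lambda>m. D ^\<^sub>m m) L\<close> that unfolding mat_tendsto_def dim_L by blast
    hence "(\<lambda>m. (C ^\<^sub>m m) $$ (i, j)) \<longlonglongrightarrow> complex_of_real (L $$ (i, j))" if "i < n" "j < n" for i j
      unfolding pow[OF that] by (rule tendsto_of_real) (fact that)+
    from peripheral_eigenvalue_pow_convergent[OF C this z] have "cmod z = 1 \<Longrightarrow> z = 1" .
    moreover have "cmod z \<le> 1"
      using z unfolding C_def by (rule eigenvalue_doubly_stochastic_le_1[OF D ds])
    ultimately show "cmod z < 1 \<or> z = 1" by linarith
  qed
  hence "(\<exists>L. mat_tendsto (\<lambda>m. D ^\<^sub>m m) L) \<longleftrightarrow> peripheral" using lim by blast
  \<comment> \<open>If the limit exists, the multiplicity of 1 is both \<open>h\<close> and the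
    number of blocks, which gives \<open>length Ds = h\<close>.\<close>
  thus ?thesis using iff lim mult_1 unfolding C_def J_def by simp
qed

end
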